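(* The monoid $\overline{\mathbb{M}}_1$ of pseudo-Dyck paths with the product $\ast$ is free on the generators $(w,1,0)$, where $w$ runs over the set of all Dyck paths (of any size $\geq 0$), together with the element $(0,1)$.
   Context: A Dyck path of size $n\geq 0$ is a word of length $2n$ in the letters $0,1$ with $n$ letters $1$ and $n$ letters $0$ such that every prefix contains at least as many $1$'s as $0$'s. A pseudo-Dyck path is a word obtained from a non-empty Dyck path by removing its first letter (a $1$) and its last letter (a $0$). The height after a prefix of a pseudo-Dyck path is its number of $1$'s minus its number of $0$'s (starting at $0$; it may reach $-1$). Product $\ast$: let $u,v$ be pseudo-Dyck paths. Write $u=(u',0^k)$ where $u'$ is empty (if $u$ is empty) or ends with the letter $1$. Write $v=v'v''$ where $v'$ is the largest prefix of $v$ in which the height stays $\geq 0$. Then $u\ast v=(u',v',0^k,v'')$, which is again a pseudo-Dyck path. This product is associative with the empty path as unit, and the resulting monoid is $\overline{\mathbb{M}}_1$. *)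

theory Defs
  imports "HOL-Algebra.Group" "HOL-Library.Sublist"
begin

datatype letter = L0 | L1

text \<open>Heights are integers, since a pseudo-Dyck path may reach height \<open>-1\<close>.\<close>

definition height :: "letter list \<Rightarrow> int" where
  "height p = int (count_list p L1) - int (count_list p L0)"

definition dyck_path_of_size :: "nat \<Rightarrow> letter list \<Rightarrow> bool" where
  "dyck_path_of_size n w \<longleftrightarrow>
     length w = 2 * n \<and> count_list w L1 = n \<and> count_list w L0 = n \<and>
     (\<forall>p. prefix p w \<longrightarrow> count_list p L0 \<le> count_list p L1)"

definition dyck_path :: "letter list \<Rightarrow> bool" where
  "dyck_path w \<longleftrightarrow> (\<exists>n. dyck_path_of_size n w)"

definition pseudo_dyck_path :: "letter list \<Rightarrow> bool" where
  "pseudo_dyck_path u \<longleftrightarrow> (\<exists>d. dyck_path d \<and> d \<noteq> [] \<and> u = butlast (tl d))"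

text \<open>A word \<open>u\<close> is split as \<open>u = strip_zeros u @ replicate (trailing_zeros u) L0\<close>, where
  \<open>strip_zeros u\<close> is empty or ends with \<open>L1\<close>.\<close>

definition strip_zeros :: "letter list \<Rightarrow> letter list" where
  "strip_zeros u = rev (dropWhile (\<lambda>a. a = L0) (rev u))"

definition trailing_zeros :: "letter list \<Rightarrow> nat" where
  "trailing_zeros u = length (takeWhile (\<lambda>a. a = L0) (rev u))"

text \<open>The empty prefix always qualifies, so the maximum below is attained, and by a unique prefix.\<close>

definition nonneg_prefix :: "letter list \<Rightarrow> letter list" where
  "nonneg_prefix v =
     (ARG_MAX length p. prefix p v \<and> (\<forall>q. prefix q p \<longrightarrow> 0 \<le> height q))"

definition nonneg_rest :: "letter list \<Rightarrow> letter list" where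
  "nonneg_rest v = drop (length (nonneg_prefix v)) v"

definition pd_mult :: "letter list \<Rightarrow> letter list \<Rightarrow> letter list" where
  "pd_mult u v =
     strip_zeros u @ nonneg_prefix v @ replicate (trailing_zeros u) L0 @ nonneg_rest v"

definition M1_bar :: "letter list monoid" where
  "M1_bar = \<lparr>carrier = {u. pseudo_dyck_path u}, mult = pd_mult, one = []\<rparr>"

definition word_monoid :: "'a set \<Rightarrow> 'a list monoid" where
  "word_monoid S = \<lparr>carrier = lists S, mult = (@), one = []\<rparr>"

text \<open>\<open>M\<close> is free on \<open>S\<close> if the homomorphism from the monoid of words over \<open>S\<close> to \<open>M\<close>
  that extends the inclusion of \<open>S\<close> is an isomorphism.\<close>

definition free_monoid_on :: "('a, 'b) monoid_scheme \<Rightarrow> 'a set \<Rightarrow> bool" where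
  "free_monoid_on M S \<longleftrightarrow>
     monoid M \<and> S \<subseteq> carrier M \<and>
     (\<lambda>xs. foldr (mult M) xs (one M)) \<in> iso (word_monoid S) M"

end

theory Submission
  imports Defs
begin

text \<open>
  Multiplying by a generator on the left is easy to describe: if \<open>v = v'v''\<close> with \<open>v'\<close> the largest
  nonnegative prefix, then \<open>01 \<ast> v = 01v\<close> and \<open>w10 \<ast> v = w1v'0v''\<close>.  A non-empty
  pseudo-Dyck path that starts with \<open>0\<close> has the form \<open>01v\<close>.  One that starts with \<open>1\<close>
  has a non-empty Dyck path as its largest nonnegative prefix; cutting that Dyck path at its last
  return to \<open>0\<close> before the end writes it as \<open>w1v'0\<close> with \<open>w\<close> and \<open>v'\<close> Dyck paths.  Both forms
  are unique, so each path has exactly one leftmost generator and one complementary factor.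
\<close>

subsection \<open>Heights\<close>

lemma height_simps [simp]:
  "height [] = 0"
  "height (L1 # w) = height w + 1"
  "height (L0 # w) = height w - 1"
  "height (u @ v) = height u + height v"
  by (simp_all add: height_def)

lemma height_replicate [simp]: "height (replicate k L0) = - int k"
  by (induction k) simp_all

text \<open>The bound is a parameter because cutting off a first part of a word shifts it: Dyck
  paths use \<open>0\<close>, pseudo-Dyck paths use \<open>-1\<close>, and their remaining parts use
  other values.\<close>

definition above :: "int \<Rightarrow> letter list \<Rightarrow> bool" where
  "above m w \<longleftrightarrow> (\<forall>p. prefix p w \<longrightarrow> m \<le> height p)"

lemma above_Cons: "above m (a # w) \<longleftrightarrow> m \<le> 0 \<and> (\<forall>p. prefix p w \<longrightarrow> m \<le> height (a # p))"
proof
  assume "above m (a # w)"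
  then have "m \<le> height p" if "prefix p (a # w)" for p
    using that by (simp add: above_def)
  from this[of "[]"] this[of "a # _"] show "m \<le> 0 \<and> (\<forall>p. prefix p w \<longrightarrow> m \<le> height (a # p))"
    by simp
next
  assume *: "m \<le> 0 \<and> (\<forall>p. prefix p w \<longrightarrow> m \<le> height (a # p))"
  show "above m (a # w)"
    unfolding above_def
  proof (intro allI impI)
    fix p assume "prefix p (a # w)"
    then show "m \<le> height p" using * by (cases p) simp_all
  qed
qed

lemma above_simps [simp]:
  "above m [] \<longleftrightarrow> m \<le> 0"
  "above m (L1 # w) \<longleftrightarrow> m \<le> 0 \<and> above (m - 1) w"
  "above m (L0 # w) \<longleftrightarrow> m \<le> 0 \<and> above (m + 1) w"
  unfolding above_Cons by (simp_all add: above_def algebra_simps)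

lemma above_le_0: "above m w \<Longrightarrow> m \<le> 0"
  unfolding above_def by (metis Nil_prefix height_simps(1))

lemma above_le_height: "above m w \<Longrightarrow> m \<le> height w"
  unfolding above_def by blast

lemma above_mono: "above m w \<Longrightarrow> n \<le> m \<Longrightarrow> above n w"
  unfolding above_def by (meson order_trans)

lemma above_0_ConsD: "above 0 (a # w) \<Longrightarrow> a = L1"
  using above_le_0[of 1 w] by (cases a) auto

lemma above_append [simp]:
  "above m (u @ v) \<longleftrightarrow> above m u \<and> above (m - height u) v"
proof (induction u arbitrary: m)
  case Nil
  then show ?case using above_le_0 by auto
next
  case (Cons a u)
  then show ?case by (cases a) (auto simp: algebra_simps)
qed

text \<open>Heights change by one at each letter, so the first letter that leads below
  \<open>m\<close> is an \<open>L0\<close> read at height exactly \<open>m\<close>. With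
  \<open>m \<le> 0\<close> the empty prefix is not yet a violation.\<close>

lemma first_passage:
  assumes "\<not> above m v" "m \<le> 0"
  shows "\<exists>d r. v = d @ L0 # r \<and> above m d \<and> height d = m"
  using assms
proof (induction v arbitrary: m)
  case (Cons a v)
  show ?case
  proof (cases "a = L0 \<and> m = 0")
    case True
    then have "a # v = [] @ L0 # v \<and> above m [] \<and> height [] = m" by simp
    then show ?thesis by blast
  next
    case False
    \<comment> \<open>The bound for \<open>v\<close> when heights are counted afresh after the
      letter \<open>a\<close>.\<close>
    define m' where "m' = (if a = L0 then m + 1 else m - 1)"
    have "\<not> above m' v \<and> m' \<le> 0"
      using Cons.prems False by (cases a) (simp_all add: m'_def)
    with Cons.IH[of m'] obtain d r
      where "v = d @ L0 # r" "above m' d" "height d = m'" by blast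
    with Cons.prems(2) have "a # v = (a # d) @ L0 # r \<and> above m (a # d) \<and> height (a # d) = m"
      by (cases a) (simp_all add: m'_def)
    then show ?thesis by blast
  qed
qed simp

text \<open>The existential size costs nothing: there are only two letters, so height
  \<open>0\<close> makes the counts equal and fixes the length as twice their value.\<close>

lemma dyck_path_iff: "dyck_path w \<longleftrightarrow> above 0 w \<and> height w = 0"
proof -
  have "length w = count_list w L0 + count_list w L1"
  proof (induction w)
    case (Cons a w)
    then show ?case by (cases a) auto
  qed simp
  then show ?thesis
    by (auto simp: dyck_path_def dyck_path_of_size_def above_def height_def)
qed

text \<open>Dropping the initial \<open>L1\<close> lowers all later heights by one, so the bound
  \<open>0\<close> turns into \<open>-1\<close>.\<close>

lemma pseudo_dyck_path_iff: "pseudo_dyck_path u \<longleftrightarrow> above (-1) u \<and> height u = 0"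
proof
  assume "pseudo_dyck_path u"
  then obtain d where d: "above 0 d" "height d = 0" "d \<noteq> []" "u = butlast (tl d)"
    by (auto simp: pseudo_dyck_path_def dyck_path_iff)
  then obtain t where t: "d = L1 # t"
    using above_0_ConsD by (metis neq_Nil_conv)
  with d have "t \<noteq> []" by auto
  then obtain x a where x: "t = x @ [a]" by (metis rev_exhaust)
  \<comment> \<open>A final \<open>L1\<close> would leave height \<open>-1\<close> just before
    it.\<close>
  have "a = L0" using d t x by (cases a) (auto dest: above_le_height)
  with d t x show "above (-1) u \<and> height u = 0" by auto
next
  assume "above (-1) u \<and> height u = 0"
  then show "pseudo_dyck_path u"
    by (auto simp: pseudo_dyck_path_def dyck_path_iff intro!: exI[of _ "L1 # u @ [L0]"])
qed

text \<open>Cut at the first passage below \<open>0\<close>. After that \<open>L0\<close> the height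
  is \<open>-1\<close>, the lowest value allowed and not the final one, so an \<open>L1\<close> must
  follow and lead back to height \<open>0\<close>.\<close>

lemma pseudo_dyck_path_split:
  assumes "pseudo_dyck_path v"
  obtains d r where "v = d @ r" "dyck_path d"
    "r = [] \<or> (\<exists>r'. r = L0 # L1 # r' \<and> pseudo_dyck_path r')"
proof (cases "above 0 v")
  case True
  with assms that[of v "[]"] show thesis by (auto simp: dyck_path_iff pseudo_dyck_path_iff)
next
  case False
  then obtain d r where d: "v = d @ L0 # r" "above 0 d" "height d = 0"
    using first_passage by blast
  with assms have r: "above 0 r" "height r = 1" by (auto simp: pseudo_dyck_path_iff)
  then obtain a r' where a: "r = a # r'" by (cases r) auto
  with r have "a = L1" using above_0_ConsD by blast
  with a d r that[of d "L0 # r"] show thesis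
    by (auto simp: dyck_path_iff pseudo_dyck_path_iff)
qed

lemma letter_neq_L1_iff: "a \<noteq> L1 \<longleftrightarrow> a = L0"
  by (cases a) auto

text \<open>A non-empty word of zeros only has negative height, so some \<open>L1\<close> occurs;
  cut at the last one.\<close>

lemma last_up_split:
  assumes "pseudo_dyck_path v" "v \<noteq> []"
  obtains q k where "v = q @ L1 # replicate k L0"
proof -
  have "\<not> set v \<subseteq> {L0}"
  proof
    assume "set v \<subseteq> {L0}"
    then have "v = replicate (length v) L0" by (intro replicate_eqI) auto
    then have "height v = - int (length v)" by (metis height_replicate)
    with assms show False by (simp add: pseudo_dyck_path_iff)
  qed
  then have "L1 \<in> set v" using letter_neq_L1_iff by blast
  then obtain q y where q: "v = q @ L1 # y" "L1 \<notin> set y" using split_list_last by force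
  have "\<And>a. a \<in> set y \<Longrightarrow> a = L0" using q(2) letter_neq_L1_iff by metis
  then have "y = replicate (length y) L0" by (intro replicate_eqI) auto
  then show thesis using that[of q "length y"] q(1) by simp
qed

subsection \<open>The product\<close>

lemma strip_zeros_eq:
  assumes "s = [] \<or> last s = L1"
  shows "strip_zeros (s @ replicate k L0) = s" "trailing_zeros (s @ replicate k L0) = k"
proof -
  have "dropWhile (\<lambda>a. a = L0) (replicate k L0 @ rev s) = rev s"
    "takeWhile (\<lambda>a. a = L0) (replicate k L0 @ rev s) = replicate k L0"
    using assms by (induction k; cases s rule: rev_cases; simp)+
  then show "strip_zeros (s @ replicate k L0) = s" "trailing_zeros (s @ replicate k L0) = k"
    by (simp_all add: strip_zeros_def trailing_zeros_def)
qed

text \<open>A prefix longer than \<open>d\<close> would contain the \<open>L0\<close> read at height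
  \<open>0\<close> and so reach \<open>-1\<close>.\<close>

lemma nonneg_prefix_eq:
  assumes "dyck_path d" "r = [] \<or> hd r = L0"
  shows "nonneg_prefix (d @ r) = d" "nonneg_rest (d @ r) = r"
proof -
  let ?P = "\<lambda>p. prefix p (d @ r) \<and> (\<forall>q. prefix q p \<longrightarrow> 0 \<le> height q)"
  have P: "?P d" using assms(1) by (auto simp: dyck_path_iff above_def)
  have max: "length p \<le> length d" if "?P p" for p
  proof (rule ccontr)
    assume long: "\<not> length p \<le> length d"
    from that have "above 0 p" by (simp add: above_def)
    have "\<not> prefix p d" using long prefix_length_le by blast
    with that obtain y where y: "p = d @ y" "prefix y r" by (auto simp: prefix_append)
    with long have "y \<noteq> []" by auto
    with y(2) assms(2) obtain y' where "y = L0 # y'" by (cases y; cases r) auto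
    with y(1) \<open>above 0 p\<close> assms(1) have "above 1 y'" by (simp add: dyck_path_iff)
    then show False using above_le_0 by fastforce
  qed
  \<comment> \<open>The maximum needs a strict bound on the lengths, hence
    \<open>Suc (length d)\<close>.\<close>
  have "?P (nonneg_prefix (d @ r))"
    unfolding nonneg_prefix_def
    by (rule arg_max_natI[of ?P d length "Suc (length d)"]) (use P max in \<open>auto simp: less_Suc_eq_le\<close>)
  moreover have "length d \<le> length (nonneg_prefix (d @ r))"
    unfolding nonneg_prefix_def
    by (rule arg_max_nat_le[of ?P d length "Suc (length d)"]) (use P max in \<open>auto simp: less_Suc_eq_le\<close>)
  ultimately show "nonneg_prefix (d @ r) = d"
    using max P by (metis append_eq_append_conv le_antisym prefixE)
  then show "nonneg_rest (d @ r) = r" by (simp add: nonneg_rest_def)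
qed

text \<open>All later products are computed with this rule: it suffices to exhibit the two
  decompositions, without returning to the maximum or to the scan for trailing zeros.\<close>

lemma pd_mult_eq:
  assumes "s = [] \<or> last s = L1" "dyck_path d" "r = [] \<or> hd r = L0"
  shows "pd_mult (s @ replicate k L0) (d @ r) = s @ d @ replicate k L0 @ r"
  using strip_zeros_eq[OF assms(1)] nonneg_prefix_eq[OF assms(2,3)] by (simp add: pd_mult_def)

section \<open>Unit, closure and associativity of the product\<close>

lemma dyck_path_Nil [simp]: "dyck_path []"
  by (simp add: dyck_path_iff)

lemma zeros_split:
  assumes "pseudo_dyck_path u"
  obtains s k where "u = s @ replicate k L0" "s = [] \<or> last s = L1"
proof (cases "u = []")
  case True
  then show thesis using that[of "[]" 0] by simp
next
  case False
  then obtain q k where "u = q @ L1 # replicate k L0"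
    using assms last_up_split by blast
  then show thesis using that[of "q @ [L1]" k] by simp
qed

lemma pd_mult_Nil [simp]:
  assumes "pseudo_dyck_path u"
  shows "pd_mult u [] = u" "pd_mult [] u = u"
proof -
  obtain s k where "u = s @ replicate k L0" "s = [] \<or> last s = L1"
    using assms by (rule zeros_split)
  then show "pd_mult u [] = u" using pd_mult_eq[of s "[]" "[]" k] by simp
  obtain d r where "u = d @ r" "dyck_path d"
    "r = [] \<or> (\<exists>r'. r = L0 # L1 # r' \<and> pseudo_dyck_path r')"
    using assms by (rule pseudo_dyck_path_split)
  then show "pd_mult [] u = u" using pd_mult_eq[of "[]" d r 0] by auto
qed

lemma pd_mult_closed:
  assumes "pseudo_dyck_path u" "pseudo_dyck_path v"
  shows "pseudo_dyck_path (pd_mult u v)"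
proof -
  obtain s k where u: "u = s @ replicate k L0" "s = [] \<or> last s = L1"
    using assms(1) by (rule zeros_split)
  obtain d r where v: "v = d @ r" "dyck_path d"
    "r = [] \<or> (\<exists>r'. r = L0 # L1 # r' \<and> pseudo_dyck_path r')"
    using assms(2) by (rule pseudo_dyck_path_split)
  have "pd_mult u v = s @ d @ replicate k L0 @ r"
    using u v by (auto intro: pd_mult_eq)
  \<comment> \<open>In the product \<open>d\<close> starts at \<open>height s \<ge> -1\<close> and
    never goes below its starting height.\<close>
  moreover have "above (- 1 - height s) d"
    using u assms(1) v(2) above_mono[of 0 d "- 1 - height s"] above_le_height[of "-1" s]
    by (auto simp: pseudo_dyck_path_iff dyck_path_iff)
  ultimately show ?thesis
    using assms u(1) v(1,2) by (auto simp: pseudo_dyck_path_iff dyck_path_iff algebra_simps)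
qed

text \<open>If \<open>v\<close> is a Dyck path, its trailing zeros join those of \<open>u\<close>,
  and \<open>e\<close> enlarges the nonnegative prefix that \<open>u\<close> meets. Otherwise the
  trailing zeros of \<open>v\<close> lie in \<open>r\<close>, so \<open>u\<close> acts around
  \<open>d\<close> and \<open>w\<close> near the end of \<open>r\<close>, independently.\<close>

lemma pd_mult_assoc:
  assumes "pseudo_dyck_path u" "pseudo_dyck_path v" "pseudo_dyck_path w"
  shows "pd_mult (pd_mult u v) w = pd_mult u (pd_mult v w)"
proof (cases "v = []")
  case True
  then show ?thesis using assms by simp
next
  case False
  obtain s k where u: "u = s @ replicate k L0" "s = [] \<or> last s = L1"
    using assms(1) by (rule zeros_split)
  obtain d r where v: "v = d @ r" "dyck_path d"
    "r = [] \<or> (\<exists>r'. r = L0 # L1 # r' \<and> pseudo_dyck_path r')"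
    using assms(2) by (rule pseudo_dyck_path_split)
  obtain e t where w: "w = e @ t" "dyck_path e"
    and t': "t = [] \<or> (\<exists>t'. t = L0 # L1 # t' \<and> pseudo_dyck_path t')"
    using assms(3) by (rule pseudo_dyck_path_split)
  from t' have t: "t = [] \<or> hd t = L0" by auto
  show ?thesis
  proof (cases "r = []")
    case True
    obtain q m where q: "v = q @ L1 # replicate m L0"
      using False assms(2) last_up_split by blast
    have "pd_mult u v = (s @ q @ [L1]) @ replicate (m + k) L0"
      using pd_mult_eq[OF u(2) v(2), of "[]" k] u v True q by (simp add: replicate_add)
    then have left: "pd_mult (pd_mult u v) w = s @ q @ L1 # e @ replicate (m + k) L0 @ t"
      using pd_mult_eq[of "s @ q @ [L1]" e t "m + k"] w t by simp
    \<comment> \<open>This is \<open>v\<close> with \<open>e\<close> inserted before its final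
      zeros; it will be the largest nonnegative prefix of \<open>pd_mult v w\<close>.\<close>
    let ?f = "q @ L1 # e @ replicate m L0"
    have vw: "pd_mult v w = ?f @ t"
      using pd_mult_eq[of "q @ [L1]" e t m] w t q by simp
    have "above 0 v" "height v = 0" using True v by (auto simp: dyck_path_iff)
    moreover have "above (- height q - 1) e"
      using \<open>above 0 v\<close> q w(2) above_mono[of 0 e "- height q - 1"] above_le_height[of 0 q]
      by (auto simp: dyck_path_iff)
    ultimately have "dyck_path ?f" using q w(2) by (auto simp: dyck_path_iff algebra_simps)
    then show ?thesis using left vw pd_mult_eq[OF u(2), of ?f t k] u(1) t by (simp add: replicate_add)
  next
    case False
    with v obtain r' where r: "r = L0 # L1 # r'" "pseudo_dyck_path r'" by auto
    then have "pseudo_dyck_path r" by (auto simp: pseudo_dyck_path_iff intro: above_mono)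
    then obtain q m where q: "r = q @ L1 # replicate m L0"
      using False last_up_split by blast
    \<comment> \<open>The word \<open>q\<close> is non-empty because \<open>r\<close> starts with
      \<open>L0\<close>. Hence the changed rest still starts with \<open>L0\<close>, and
      \<open>d\<close> remains the nonnegative prefix of \<open>pd_mult v w\<close>.\<close>
    have hq: "\<And>x. hd (q @ L1 # x) = L0" using q r by (cases q) auto
    have "pd_mult u v = (s @ d @ replicate k L0 @ q @ [L1]) @ replicate m L0"
      using pd_mult_eq[OF u(2) v(2), of r k] u(1) v(1) r(1) q by simp
    then have "pd_mult (pd_mult u v) w
        = s @ d @ replicate k L0 @ q @ L1 # e @ replicate m L0 @ t"
      using pd_mult_eq[of "s @ d @ replicate k L0 @ q @ [L1]" e t m] w t by simp
    moreover have "pd_mult v w = d @ q @ L1 # e @ replicate m L0 @ t"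
      using pd_mult_eq[of "d @ q @ [L1]" e t m] w t v(1) q by simp
    ultimately show ?thesis
      using pd_mult_eq[OF u(2) v(2), of "q @ L1 # e @ replicate m L0 @ t" k] u(1) hq by simp
  qed
qed

lemma monoid_M1_bar: "monoid M1_bar"
  by (rule monoidI)
    (simp_all add: M1_bar_def pd_mult_closed pd_mult_assoc, simp add: pseudo_dyck_path_iff)

subsection \<open>Factoring out a generator on the left\<close>

text \<open>The generator has no trailing zero to move, so the two parts of \<open>v\<close> rejoin
  unchanged.\<close>

lemma pd_mult_down_up:
  assumes "pseudo_dyck_path v"
  shows "pd_mult [L0, L1] v = L0 # L1 # v"
proof -
  obtain d r where "v = d @ r" "dyck_path d"
    "r = [] \<or> (\<exists>r'. r = L0 # L1 # r' \<and> pseudo_dyck_path r')"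
    using assms by (rule pseudo_dyck_path_split)
  then show ?thesis using pd_mult_eq[of "[L0, L1]" d r 0] by auto
qed

lemma pd_mult_peak:
  assumes "dyck_path d" "r = [] \<or> hd r = L0"
  shows "pd_mult (w @ [L1, L0]) (d @ r) = w @ L1 # d @ L0 # r"
  using pd_mult_eq[of "w @ [L1]" d r 1] assms by simp

text \<open>Cut at the first return, \<open>d = L1 # x @ L0 # y\<close>. If \<open>y\<close> is
  empty, \<open>w\<close> is empty; otherwise the last return inside \<open>y\<close> is also that
  of \<open>d\<close>, and \<open>L1 # x @ [L0]\<close> is put in front of its
  \<open>w\<close>.\<close>

lemma dyck_path_last_return:
  assumes "dyck_path d" "d \<noteq> []"
  shows "\<exists>w a. d = w @ L1 # a @ [L0] \<and> dyck_path w \<and> dyck_path a"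
  using assms
proof (induction d rule: length_induct)
  case (1 d)
  then obtain c t where c: "d = c # t" by (cases d) auto
  with 1(2) have "c = L1" using above_0_ConsD[of c t] by (simp add: dyck_path_iff)
  with c 1(2) have "above (-1) t" "height t = -1" by (auto simp: dyck_path_iff)
  moreover from this have "\<not> above 0 t" using above_le_height by fastforce
  ultimately obtain x y where xy: "t = x @ L0 # y" "dyck_path x" "dyck_path y"
    using first_passage[of 0 t] by (auto simp: dyck_path_iff)
  show ?case
  proof (cases "y = []")
    case True
    with xy c \<open>c = L1\<close> have "d = [] @ L1 # x @ [L0]" by simp
    with xy(2) show ?thesis using dyck_path_Nil by blast
  next
    case False
    then obtain w a where "y = w @ L1 # a @ [L0]" "dyck_path w" "dyck_path a"
      using 1(1)[rule_format, of y] xy c by auto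
    with xy c \<open>c = L1\<close> have "d = (L1 # x @ L0 # w) @ L1 # a @ [L0]" "dyck_path (L1 # x @ L0 # w)"
      using above_mono[of 0 x "-1"] by (auto simp: dyck_path_iff)
    with \<open>dyck_path a\<close> show ?thesis by blast
  qed
qed

text \<open>If the cuts differed, the word \<open>us\<close> between them would have height
  \<open>0\<close> and end strictly inside the last arch of one of the decompositions, where heights
  are at least \<open>1\<close>.\<close>

lemma dyck_path_last_return_unique:
  assumes "w @ L1 # a @ [L0] = w' @ L1 # a' @ [L0]"
    and "dyck_path w" "dyck_path a" "dyck_path w'" "dyck_path a'"
  shows "w = w' \<and> a = a'"
proof -
  have no_later_return: "us = []"
    if "us @ L1 # x = L1 # y" "height us = 0" "dyck_path y" for us x y
  proof (rule ccontr)
    assume "us \<noteq> []"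
    with that(1) obtain us' where "us = L1 # us'" "y = us' @ L1 # x" by (cases us) auto
    with that show False using above_le_height[of 0 us'] by (auto simp: dyck_path_iff)
  qed
  from assms(1) have "w @ L1 # a = w' @ L1 # a'"
    by (metis append.assoc append_Cons butlast_snoc)
  then obtain us where "w = w' @ us \<and> us @ L1 # a = L1 # a' \<or> w @ us = w' \<and> L1 # a = us @ L1 # a'"
    by (auto simp: append_eq_append_conv2)
  then show ?thesis
  proof
    assume *: "w = w' @ us \<and> us @ L1 # a = L1 # a'"
    then have "us = []" using assms by (intro no_later_return[of us a a']) (auto simp: dyck_path_iff)
    with * show ?thesis by simp
  next
    assume *: "w @ us = w' \<and> L1 # a = us @ L1 # a'"
    then have "us = []" using assms by (intro no_later_return[of us a' a]) (auto simp: dyck_path_iff)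
    with * show ?thesis by simp
  qed
qed

section \<open>Existence and uniqueness of the leftmost generator\<close>

abbreviation (input) generators :: "letter list set" where
  "generators \<equiv> {w @ [L1, L0] | w. dyck_path w} \<union> {[L0, L1]}"

lemma generators_pseudo_dyck_path: "g \<in> generators \<Longrightarrow> pseudo_dyck_path g"
  using above_mono[of 0 _ "-1"] by (auto simp: pseudo_dyck_path_iff dyck_path_iff)

text \<open>The drop in length is what lets repeated factoring end at the empty path.\<close>

lemma ex_left_generator:
  assumes "pseudo_dyck_path u" "u \<noteq> []"
  shows "\<exists>g v. g \<in> generators \<and> pseudo_dyck_path v \<and> length v < length u \<and> u = pd_mult g v"
proof -
  obtain d r where u: "u = d @ r" "dyck_path d"
    and r: "r = [] \<or> (\<exists>r'. r = L0 # L1 # r' \<and> pseudo_dyck_path r')"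
    using assms(1) by (rule pseudo_dyck_path_split)
  show ?thesis
  proof (cases "d = []")
    case True
    with r u assms(2) obtain r' where "u = L0 # L1 # r'" "pseudo_dyck_path r'" by auto
    moreover from this have "u = pd_mult [L0, L1] r'" "length r' < length u"
      by (simp_all add: pd_mult_down_up)
    ultimately show ?thesis by blast
  next
    case False
    with u obtain w a where d: "d = w @ L1 # a @ [L0]" "dyck_path w" "dyck_path a"
      using dyck_path_last_return by blast
    \<comment> \<open>The \<open>L0\<close> closing the last arch of \<open>d\<close> is the
      trailing zero of the generator, moved behind \<open>a\<close>.\<close>
    have "u = pd_mult (w @ [L1, L0]) (a @ r)"
      using pd_mult_peak[of a r w] r d u by auto
    moreover have "pseudo_dyck_path (a @ r)"
      using d(3) r above_mono[of 0 a "-1"] by (auto simp: pseudo_dyck_path_iff dyck_path_iff)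
    moreover have "length (a @ r) < length u" using d(1) u(1) by simp
    ultimately show ?thesis using d(2) by blast
  qed
qed

text \<open>Displays the product with its largest nonnegative prefix in front, so that this prefix,
  and from it \<open>w\<close> and \<open>a\<close>, can be recovered.\<close>

lemma pd_mult_peak_cases:
  assumes "dyck_path w" "pseudo_dyck_path v"
  obtains a r where "v = a @ r" "dyck_path a" "r = [] \<or> hd r = L0"
    "pd_mult (w @ [L1, L0]) v = (w @ L1 # a @ [L0]) @ r" "dyck_path (w @ L1 # a @ [L0])"
proof -
  obtain a r where v: "v = a @ r" "dyck_path a"
    "r = [] \<or> (\<exists>r'. r = L0 # L1 # r' \<and> pseudo_dyck_path r')"
    using assms(2) by (rule pseudo_dyck_path_split)
  then have r: "r = [] \<or> hd r = L0" by auto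
  have "dyck_path (w @ L1 # a @ [L0])"
    using assms(1) v(2) above_mono[of 0 a "-1"] by (auto simp: dyck_path_iff)
  with that[OF v(1,2) r] v r show thesis using pd_mult_peak[of a r w] by simp
qed

lemma hd_dyck_path: "dyck_path d \<Longrightarrow> d \<noteq> [] \<Longrightarrow> hd d = L1"
  using above_0_ConsD by (cases d) (auto simp: dyck_path_iff)

lemma pd_mult_generator_neq_Nil:
  assumes "g \<in> generators" "pseudo_dyck_path v"
  shows "pd_mult g v \<noteq> []"
  using assms pd_mult_down_up by (auto elim: pd_mult_peak_cases)

text \<open>The first letter separates the two kinds of generator, since products with
  \<open>[L0, L1]\<close> start with \<open>L0\<close>.\<close>

lemma pd_mult_generator_hd:
  assumes "dyck_path w" "pseudo_dyck_path v"
  shows "hd (pd_mult (w @ [L1, L0]) v) = L1"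
  using assms by (rule pd_mult_peak_cases) (metis Nil_is_append_conv hd_append hd_dyck_path list.distinct(1))

lemma left_generator_unique:
  assumes "g \<in> generators" "h \<in> generators" "pseudo_dyck_path u" "pseudo_dyck_path v"
    and eq: "pd_mult g u = pd_mult h v"
  shows "g = h \<and> u = v"
proof -
  have peak: ?thesis if gens: "dyck_path w" "dyck_path w'" "g = w @ [L1, L0]" "h = w' @ [L1, L0]" for w w'
  proof -
    obtain a r where 1: "u = a @ r" "dyck_path a" "r = [] \<or> hd r = L0"
      "pd_mult g u = (w @ L1 # a @ [L0]) @ r" "dyck_path (w @ L1 # a @ [L0])"
      using pd_mult_peak_cases[OF gens(1) assms(3)] gens(3) by metis
    obtain b t where 2: "v = b @ t" "dyck_path b" "t = [] \<or> hd t = L0"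
      "pd_mult h v = (w' @ L1 # b @ [L0]) @ t" "dyck_path (w' @ L1 # b @ [L0])"
      using pd_mult_peak_cases[OF gens(2) assms(4)] gens(4) by metis
    \<comment> \<open>Both sides are the largest nonnegative prefix of the same word, and
      \<open>r\<close> and \<open>t\<close> are its rest.\<close>
    have "w @ L1 # a @ [L0] = w' @ L1 # b @ [L0]" "r = t"
      using nonneg_prefix_eq[OF 1(5,3)] nonneg_prefix_eq[OF 2(5,3)] eq 1(4) 2(4) by metis+
    with dyck_path_last_return_unique[OF this(1)] gens 1 2 show ?thesis by auto
  qed
  consider "g = [L0, L1]" "h = [L0, L1]"
    | w where "g = [L0, L1]" "dyck_path w" "h = w @ [L1, L0]"
    | w where "h = [L0, L1]" "dyck_path w" "g = w @ [L1, L0]"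
    | w w' where "dyck_path w" "dyck_path w'" "g = w @ [L1, L0]" "h = w' @ [L1, L0]"
    using assms(1,2) by blast
  then show ?thesis
  proof cases
    case 1
    with eq assms(3,4) show ?thesis by (simp add: pd_mult_down_up)
  next
    case 2
    with eq assms(3) pd_mult_generator_hd[OF 2(2) assms(4)] show ?thesis
      by (metis letter.distinct(1) list.sel(1) pd_mult_down_up)
  next
    case 3
    with eq assms(4) pd_mult_generator_hd[OF 3(2) assms(3)] show ?thesis
      by (metis letter.distinct(1) list.sel(1) pd_mult_down_up)
  next
    case 4
    then show ?thesis by (rule peak)
  qed
qed

subsection \<open>Freeness\<close>

lemma (in monoid) foldr_mult_closed:
  "set xs \<subseteq> carrier G \<Longrightarrow> foldr (\<otimes>) xs \<one> \<in> carrier G"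
  by (induction xs) auto

lemma (in monoid) foldr_mult_append:
  "set xs \<subseteq> carrier G \<Longrightarrow> set ys \<subseteq> carrier G \<Longrightarrow>
    foldr (\<otimes>) (xs @ ys) \<one> = foldr (\<otimes>) xs \<one> \<otimes> foldr (\<otimes>) ys \<one>"
proof (induction xs)
  case Nil
  then show ?case using foldr_mult_closed by simp
next
  case (Cons x xs)
  then show ?case
    using foldr_mult_closed[of xs] foldr_mult_closed[of ys] by (simp add: m_assoc)
qed

text \<open>A criterion by left factors. Peeling off first generators gives injectivity, with
  \<open>neq_one\<close> excluding that one word runs out before the other; induction on
  \<open>size_of\<close> gives surjectivity.\<close>

lemma (in monoid) free_monoid_onI:
  assumes "S \<subseteq> carrier G"
    and neq_one: "\<And>g v. g \<in> S \<Longrightarrow> v \<in> carrier G \<Longrightarrow> g \<otimes> v \<noteq> \<one>"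
    and unique: "\<And>g h u v. g \<in> S \<Longrightarrow> h \<in> S \<Longrightarrow> u \<in> carrier G \<Longrightarrow> v \<in> carrier G \<Longrightarrow>
      g \<otimes> u = h \<otimes> v \<Longrightarrow> g = h \<and> u = v"
    and factor: "\<And>u. u \<in> carrier G \<Longrightarrow> u \<noteq> \<one> \<Longrightarrow>
      \<exists>g v. g \<in> S \<and> v \<in> carrier G \<and> size_of v < (size_of u :: nat) \<and> u = g \<otimes> v"
  shows "free_monoid_on G S"
proof -
  let ?h = "\<lambda>xs. foldr (\<otimes>) xs \<one>"
  have lists: "set xs \<subseteq> carrier G" if "xs \<in> lists S" for xs
    using that assms(1) by auto
  have "?h \<in> hom (word_monoid S) G"
    using lists by (auto simp: hom_def word_monoid_def foldr_mult_append simp del: foldr_append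
        intro!: foldr_mult_closed)
  moreover have "inj_on ?h (lists S)"
  proof (rule inj_onI)
    fix xs ys assume "xs \<in> lists S" "ys \<in> lists S" "?h xs = ?h ys"
    then show "xs = ys"
    proof (induction xs arbitrary: ys rule: list.induct)
      case Nil
      show ?case
      proof (cases ys)
        case (Cons y ys')
        with Nil neq_one[of y "?h ys'"] foldr_mult_closed[OF lists[of ys']] show ?thesis by auto
      qed simp
    next
      case (Cons x xs)
      have xs: "x \<in> S" "xs \<in> lists S" using Cons.prems(1) by auto
      from Cons.prems(3) have "ys \<noteq> []"
        using neq_one[OF xs(1) foldr_mult_closed[OF lists[OF xs(2)]]] by auto
      then obtain y ys' where ys: "ys = y # ys'" "y \<in> S" "ys' \<in> lists S"
        using Cons.prems(2) by (cases ys) auto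
      have "x = y \<and> ?h xs = ?h ys'"
        using unique[OF xs(1) ys(2)] foldr_mult_closed[OF lists[OF xs(2)]]
          foldr_mult_closed[OF lists[OF ys(3)]] ys(1) Cons.prems(3) by simp
      with Cons.IH xs ys show ?case by auto
    qed
  qed
  moreover have "?h ` lists S = carrier G"
  proof
    show "?h ` lists S \<subseteq> carrier G" using foldr_mult_closed lists by blast
    show "carrier G \<subseteq> ?h ` lists S"
    proof
      fix u assume "u \<in> carrier G"
      then show "u \<in> ?h ` lists S"
      proof (induction u rule: measure_induct_rule[of size_of])
        case (less u)
        show ?case
        proof (cases "u = \<one>")
          case True
          then show ?thesis by (intro image_eqI[of _ _ "[]"]) auto
        next
          case False
          with factor less.prems obtain g v
            where g: "g \<in> S" "v \<in> carrier G" "size_of v < size_of u" "u = g \<otimes> v" by blast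
          with less.IH obtain xs where "xs \<in> lists S" "v = ?h xs" by blast
          with g show ?thesis by (intro image_eqI[of _ _ "g # xs"]) auto
        qed
      qed
    qed
  qed
  ultimately show ?thesis
    using assms(1) monoid_axioms
    by (simp add: free_monoid_on_def iso_def bij_betw_def word_monoid_def)
qed

theorem proposition2p6:
  "free_monoid_on M1_bar ({w @ [L1, L0] | w. dyck_path w} \<union> {[L0, L1]})"
proof (rule monoid.free_monoid_onI[OF monoid_M1_bar, where size_of = length])
  show "generators \<subseteq> carrier M1_bar"
    using generators_pseudo_dyck_path by (auto simp: M1_bar_def)
  show "g \<otimes>\<^bsub>M1_bar\<^esub> v \<noteq> \<one>\<^bsub>M1_bar\<^esub>" if "g \<in> generators" "v \<in> carrier M1_bar" for g v
    using that pd_mult_generator_neq_Nil by (simp add: M1_bar_def)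
  show "g = h \<and> u = v"
    if "g \<in> generators" "h \<in> generators" "u \<in> carrier M1_bar" "v \<in> carrier M1_bar"
      "g \<otimes>\<^bsub>M1_bar\<^esub> u = h \<otimes>\<^bsub>M1_bar\<^esub> v" for g h u v
    using left_generator_unique[OF that(1,2)] that(3-5) by (simp add: M1_bar_def)
  show "\<exists>g v. g \<in> generators \<and> v \<in> carrier M1_bar \<and> length v < length u \<and>
      u = g \<otimes>\<^bsub>M1_bar\<^esub> v" if "u \<in> carrier M1_bar" "u \<noteq> \<one>\<^bsub>M1_bar\<^esub>" for u
    using ex_left_generator that by (simp add: M1_bar_def)
qed

end
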